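(* Every conservative, consistent, monotone finite volume method on the network (of the form given in the context, with the stated initialization) is $L^1$-contractive: if $\mathbf{u}_{\Delta t}$ and $\mathbf{v}_{\Delta t}$ are the piecewise constant projections of the numerical solutions computed with initial data $\bar{\mathbf{u}},\bar{\mathbf{v}}\in L^\infty_{\mathrm{oco}}(\mathcal{G}^0_{\mathrm{disc}})\cap L^1(\Omega;\lambda)$ respectively, where $\mathcal{G}^0_{\mathrm{disc}}$ is a set of discrete stationary solutions of the method, then $$\big\|\mathbf{u}_{\Delta t}(\cdot,t)-\mathbf{v}_{\Delta t}(\cdot,t)\big\|_{L^1(\Omega;\lambda)}\leq\big\|\bar{\mathbf{u}}-\bar{\mathbf{v}}\big\|_{L^1(\Omega;\lambda)}\qquad\text{for all }t\geq0.$$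
   Context: **Network.** Fix integers $N_{\mathrm{in}},N_{\mathrm{out}}\geq1$, $N=N_{\mathrm{in}}+N_{\mathrm{out}}$, $\mathcal{I}_{\mathrm{in}}=\{-N_{\mathrm{in}},\dots,-1\}$, $\mathcal{I}_{\mathrm{out}}=\{1,\dots,N_{\mathrm{out}}\}$, $\mathcal{I}=\mathcal{I}_{\mathrm{in}}\cup\mathcal{I}_{\mathrm{out}}$. $D^k=(-\infty,0)$ for $k\in\mathcal{I}_{\mathrm{in}}$, $D^k=(0,\infty)$ for $k\in\mathcal{I}_{\mathrm{out}}$; fluxes $f^k:\mathbb{R}\to\mathbb{R}$ are continuous, and the conservation law $u^k_t+f^k(u^k)_x=0$ is posed on each $D^k$. $\Omega=\bigcup_{k\in\mathcal{I}}D^k\times\{k\}$, $\lambda=$ (Lebesgue)$\times$(counting measure), so $\int_\Omega\mathbf{u}\,d\lambda=\sum_k\int_{D^k}u^k\,dx$ for $\mathbf{u}=(u^k)_{k\in\mathcal{I}}$. **Finite volume method.** Let $\Delta t,\Delta x>0$, $t^n=n\Delta t$, $x_{i+1/2}=(i+\tfrac12)\Delta x$, cells $\mathcal{C}^k_i=D^k\cap(x_{i-1/2},x_{i+1/2})$, $\Delta x_0=N\Delta x/2$, $D^k_{\mathrm{disc}}=\{1,2,\dots\}$ for $k\in\mathcal{I}_{\mathrm{out}}$, $D^k_{\mathrm{disc}}=\{-1,-2,\dots\}$ for $k\in\mathcal{I}_{\mathrm{in}}$. Given numerical fluxes $F^k:\mathbb{R}^2\to\mathbb{R}$, the method is $$u_i^{k,n+1}=u_i^{k,n}-\tfrac{\Delta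 t}{\Delta x}\big(F^k(u_i^{k,n},u_{i+1}^{k,n})-F^k(u_{i-1}^{k,n},u_i^{k,n})\big)\quad(i\in D^k_{\mathrm{disc}},\ k\in\mathcal{I}),$$ $$u_0^{n+1}=u_0^n-\tfrac{\Delta t}{\Delta x_0}\Big(\sum_{k\in\mathcal{I}_{\mathrm{out}}}F^k(u_0^n,u_1^{k,n})-\sum_{k\in\mathcal{I}_{\mathrm{in}}}F^k(u_{-1}^{k,n},u_0^n)\Big),$$ with the convention $u_0^{k,n}=u_0^n$ for all $k$ (a method of this form is conservative: the total mass is independent of $n$). It is consistent if $F^k(u,u)=f^k(u)$ for all $u$ and $k$, and monotone if $\mathbf{u}^n\leq\mathbf{v}^n$ (every component) implies $\mathbf{u}^{n+1}\leq\mathbf{v}^{n+1}$. Set $\mathbf{u}_{\Delta t}(x,k,t)=u_i^{k,n}$ for $x\in\mathcal{C}_i^k$, $t\in[t^n,t^{n+1})$. **Discrete stationary solution.** A vector $\mathbf{c}=(c^{-N_{\mathrm{in}}},\dots,c^{-1},c^0,c^1,\dots,c^{N_{\mathrm{out}}})\in\mathbb{R}^{N+1}$ with $\sum_{k\in\mathcal{I}_{\mathrm{in}}}f^k(c^k)=\sum_{k\in\mathcal{I}_{\mathrm{out}}}f^k(c^k)$, $F^k(c^k,c^0)=f^k(c^k)$ for $k\in\mathcal{I}_{\mathrm{in}}$ and $F^k(c^0,c^k)=f^k(c^k)$ for $k\in\mathcal{I}_{\mathrm{out}}$. **Initial data class.** $L^\infty_{\mathrm{oco}}(\mathcal{G}^0_{\mathrm{disc}})$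 is the set of $\mathbf{u}\in L^\infty(\Omega;\lambda)$ for which there are $\mathbf{c},\mathbf{d}\in\mathcal{G}^0_{\mathrm{disc}}$ such that, for all $k,l\in\mathcal{I}$ (the vertex index $0$ is ignored): every $\alpha\in[c^k,d^k]$ is the $k$-th component of some element of $\mathcal{G}^0_{\mathrm{disc}}$; $c^k\leq u^k(x)\leq d^k$ for (a.e.) $x\in D^k$; and $c^k\leq d^l$. **Initialization.** Choose $\mathbf{c},\mathbf{d}$ for $\bar{\mathbf{u}}$ as in that definition, their vertex values being modified if necessary so that both remain discrete stationary solutions and $c^0\leq d^0$. Set $u_i^{k,0}=\frac1{\Delta x}\int_{\mathcal{C}_i^k}\bar u^k\,dx$ for $i\in D^k_{\mathrm{disc}}$, $k\in\mathcal{I}$, and $u_0^0=c^0$; likewise for $\bar{\mathbf{v}}$.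
   Formalization: The inequality as stated fails when the initial vertex values differ; it is proved when u_0^0 = v_0^0, and for all admissible choices with the extra term Δx_0·|u_0^0 − v_0^0| added to the right-hand side. *)

theory Defs
  imports "HOL-Analysis.Analysis"
begin

section \<open>The network\<close>

definition edges_in :: "nat \<Rightarrow> int set" where
  "edges_in Nin = {- int Nin..-1}"

definition edges_out :: "nat \<Rightarrow> int set" where
  "edges_out Nout = {1..int Nout}"

definition edges :: "nat \<Rightarrow> nat \<Rightarrow> int set" where
  "edges Nin Nout = edges_in Nin \<union> edges_out Nout"

definition edge_dom :: "int \<Rightarrow> real set" where
  "edge_dom k = (if k < 0 then {..<0} else {0<..})"

definition Omega :: "nat \<Rightarrow> nat \<Rightarrow> (real \<times> int) set" where
  "Omega Nin Nout = {(x, k). k \<in> edges Nin Nout \<and> x \<in> edge_dom k}"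

definition net_measure :: "nat \<Rightarrow> nat \<Rightarrow> (real \<times> int) measure" where
  "net_measure Nin Nout =
     restrict_space (lebesgue \<Otimes>\<^sub>M count_space (edges Nin Nout)) (Omega Nin Nout)"

text \<open>The norm of \<open>L\<^sup>1(\<Omega>; \<lambda>)\<close>, with values in \<open>[0, \<infinity>]\<close>: a bound
  \<open>L1_norm Nin Nout u \<le> a\<close> with finite \<open>a\<close> includes the finiteness of the integral.\<close>

definition L1_norm :: "nat \<Rightarrow> nat \<Rightarrow> (real \<times> int \<Rightarrow> real) \<Rightarrow> ennreal" where
  "L1_norm Nin Nout u = (\<integral>\<^sup>+ z. ennreal \<bar>u z\<bar> \<partial>net_measure Nin Nout)"

definition Linf :: "nat \<Rightarrow> nat \<Rightarrow> (real \<times> int \<Rightarrow> real) set" where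
  "Linf Nin Nout = {u \<in> borel_measurable (net_measure Nin Nout).
     \<exists>C. AE z in net_measure Nin Nout. \<bar>u z\<bar> \<le> C}"

definition L1 :: "nat \<Rightarrow> nat \<Rightarrow> (real \<times> int \<Rightarrow> real) set" where
  "L1 Nin Nout = {u. integrable (net_measure Nin Nout) u}"


section \<open>The finite volume method\<close>

definition disc_dom :: "int \<Rightarrow> int set" where
  "disc_dom k = (if k < 0 then {..-1} else {1..})"

definition cell :: "real \<Rightarrow> int \<Rightarrow> int \<Rightarrow> real set" where
  "cell dx k i = edge_dom k \<inter> {(real_of_int i - 1/2) * dx <..< (real_of_int i + 1/2) * dx}"

definition vertex_width :: "nat \<Rightarrow> nat \<Rightarrow> real \<Rightarrow> real" where
  "vertex_width Nin Nout dx = real (Nin + Nout) * dx / 2"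

text \<open>The state of the method at one time level. Only the entries \<open>edge w k i\<close> with
  \<open>k \<in> edges Nin Nout\<close> and \<open>i \<in> disc_dom k\<close> are meaningful. The function \<open>gval\<close> implements the
  convention \<open>u\<^sub>0\<^sup>k = u\<^sub>0\<close> for all \<open>k\<close>.\<close>

record net_grid =
  vertex :: real
  edge :: "int \<Rightarrow> int \<Rightarrow> real"

definition gval :: "net_grid \<Rightarrow> int \<Rightarrow> int \<Rightarrow> real" where
  "gval w k i = (if i = 0 then vertex w else edge w k i)"

definition grid_le :: "nat \<Rightarrow> nat \<Rightarrow> net_grid \<Rightarrow> net_grid \<Rightarrow> bool" where
  "grid_le Nin Nout u v \<longleftrightarrow> vertex u \<le> vertex v \<and>
     (\<forall>k\<in>edges Nin Nout. \<forall>i\<in>disc_dom k. edge u k i \<le> edge v k i)"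

definition fv_step :: "nat \<Rightarrow> nat \<Rightarrow> (int \<Rightarrow> real \<Rightarrow> real \<Rightarrow> real) \<Rightarrow> real \<Rightarrow> real
    \<Rightarrow> net_grid \<Rightarrow> net_grid" where
  "fv_step Nin Nout F dt dx w =
    \<lparr> vertex = vertex w - dt / vertex_width Nin Nout dx *
        ((\<Sum>k\<in>edges_out Nout. F k (gval w k 0) (gval w k 1))
         - (\<Sum>k\<in>edges_in Nin. F k (gval w k (-1)) (gval w k 0))),
      edge = (\<lambda>k i. gval w k i - dt / dx *
        (F k (gval w k i) (gval w k (i + 1)) - F k (gval w k (i - 1)) (gval w k i))) \<rparr>"

definition consistent_flux :: "nat \<Rightarrow> nat \<Rightarrow> (int \<Rightarrow> real \<Rightarrow> real)
    \<Rightarrow> (int \<Rightarrow> real \<Rightarrow> real \<Rightarrow> real) \<Rightarrow> bool" where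
  "consistent_flux Nin Nout f F \<longleftrightarrow> (\<forall>k\<in>edges Nin Nout. \<forall>u. F k u u = f k u)"

definition monotone_fv :: "nat \<Rightarrow> nat \<Rightarrow> (int \<Rightarrow> real \<Rightarrow> real \<Rightarrow> real) \<Rightarrow> real \<Rightarrow> real \<Rightarrow> bool" where
  "monotone_fv Nin Nout F dt dx \<longleftrightarrow>
    (\<forall>u v. grid_le Nin Nout u v \<longrightarrow>
       grid_le Nin Nout (fv_step Nin Nout F dt dx u) (fv_step Nin Nout F dt dx v))"

text \<open>Vectors \<open>c = (c\<^sup>k)\<close> indexed by \<open>{-Nin..Nout}\<close>, with vertex component \<open>c 0\<close>, are functions
  on \<open>int\<close> whose values at other indices are irrelevant.\<close>

definition discrete_stationary :: "nat \<Rightarrow> nat \<Rightarrow> (int \<Rightarrow> real \<Rightarrow> real)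
    \<Rightarrow> (int \<Rightarrow> real \<Rightarrow> real \<Rightarrow> real) \<Rightarrow> (int \<Rightarrow> real) set" where
  "discrete_stationary Nin Nout f F = {c.
     (\<Sum>k\<in>edges_in Nin. f k (c k)) = (\<Sum>k\<in>edges_out Nout. f k (c k)) \<and>
     (\<forall>k\<in>edges_in Nin. F k (c k) (c 0) = f k (c k)) \<and>
     (\<forall>k\<in>edges_out Nout. F k (c 0) (c k) = f k (c k))}"


section \<open>Initial data\<close>

definition oco_bounds :: "nat \<Rightarrow> nat \<Rightarrow> (int \<Rightarrow> real) set \<Rightarrow> (real \<times> int \<Rightarrow> real)
    \<Rightarrow> (int \<Rightarrow> real) \<Rightarrow> (int \<Rightarrow> real) \<Rightarrow> bool" where
  "oco_bounds Nin Nout G u c d \<longleftrightarrow> c \<in> G \<and> d \<in> G \<and>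
     (\<forall>k\<in>edges Nin Nout. \<forall>l\<in>edges Nin Nout.
        (\<forall>\<alpha>\<in>{c k..d k}. \<exists>g\<in>G. g k = \<alpha>) \<and>
        (AE x in lebesgue_on (edge_dom k). c k \<le> u (x, k) \<and> u (x, k) \<le> d k) \<and>
        c k \<le> d l)"

definition Linf_oco :: "nat \<Rightarrow> nat \<Rightarrow> (int \<Rightarrow> real) set \<Rightarrow> (real \<times> int \<Rightarrow> real) set" where
  "Linf_oco Nin Nout G = {u \<in> Linf Nin Nout. \<exists>c d. oco_bounds Nin Nout G u c d}"

text \<open>The pairs \<open>(c, d)\<close> admitted by the initialization: bounds for \<open>u\<close> from \<open>G\<close>, up to a change
  of the vertex values that keeps both vectors discrete stationary solutions and gives
  \<open>c\<^sup>0 \<le> d\<^sup>0\<close>.\<close>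

definition init_bounds :: "nat \<Rightarrow> nat \<Rightarrow> (int \<Rightarrow> real \<Rightarrow> real) \<Rightarrow> (int \<Rightarrow> real \<Rightarrow> real \<Rightarrow> real)
    \<Rightarrow> (int \<Rightarrow> real) set \<Rightarrow> (real \<times> int \<Rightarrow> real) \<Rightarrow> (int \<Rightarrow> real) \<Rightarrow> (int \<Rightarrow> real) \<Rightarrow> bool" where
  "init_bounds Nin Nout f F G u c d \<longleftrightarrow>
     (\<exists>c' d'. oco_bounds Nin Nout G u c' d' \<and>
        (\<forall>k\<in>edges Nin Nout. c k = c' k \<and> d k = d' k)) \<and>
     c \<in> discrete_stationary Nin Nout f F \<and> d \<in> discrete_stationary Nin Nout f F \<and>
     c 0 \<le> d 0"

text \<open>The initial vertex value \<open>c\<^sup>0\<close> is not determined by \<open>u\<close>: different admissible \<open>c\<close>, even for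
  the same \<open>u\<close>, may have different vertex values. The vertex cells have total length
  \<open>vertex_width\<close>, so two initial grids that differ only in the vertex values \<open>a\<close> and \<open>b\<close> are at
  \<open>L\<^sup>1\<close> distance \<open>vertex_width Nin Nout dx * \<bar>a - b\<bar>\<close>.\<close>

definition init_grid :: "real \<Rightarrow> (real \<times> int \<Rightarrow> real) \<Rightarrow> (int \<Rightarrow> real) \<Rightarrow> net_grid" where
  "init_grid dx u c =
    \<lparr> vertex = c 0,
      edge = (\<lambda>k i. 1 / dx * (LINT x:cell dx k i|lebesgue. u (x, k))) \<rparr>"

definition fv_solution :: "nat \<Rightarrow> nat \<Rightarrow> (int \<Rightarrow> real \<Rightarrow> real \<Rightarrow> real) \<Rightarrow> real \<Rightarrow> real
    \<Rightarrow> (real \<times> int \<Rightarrow> real) \<Rightarrow> (int \<Rightarrow> real) \<Rightarrow> nat \<Rightarrow> net_grid" where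
  "fv_solution Nin Nout F dt dx u c n = (fv_step Nin Nout F dt dx ^^ n) (init_grid dx u c)"

text \<open>The piecewise constant projection. By \<open>cell_index\<close> and \<open>time_index\<close> below, for \<open>x\<close> in
  \<open>cell dx k i\<close> and \<open>t\<close> in \<open>[n dt, (n + 1) dt)\<close> its value is \<open>u\<^sub>i\<close> at time level \<open>n\<close>; the
  remaining points \<open>x\<close> are the cell interfaces, a null set, where the value is taken from one of
  the two adjacent cells.\<close>

definition fv_projection :: "nat \<Rightarrow> nat \<Rightarrow> (int \<Rightarrow> real \<Rightarrow> real \<Rightarrow> real) \<Rightarrow> real \<Rightarrow> real
    \<Rightarrow> (real \<times> int \<Rightarrow> real) \<Rightarrow> (int \<Rightarrow> real) \<Rightarrow> real \<Rightarrow> real \<times> int \<Rightarrow> real" where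
  "fv_projection Nin Nout F dt dx u c t =
    (\<lambda>(x, k). gval (fv_solution Nin Nout F dt dx u c (nat \<lfloor>t / dt\<rfloor>)) k \<lfloor>x / dx + 1/2\<rfloor>)"

lemma cell_index:
  assumes "0 < dx" "x \<in> cell dx k i"
  shows "\<lfloor>x / dx + 1/2\<rfloor> = i"
proof -
  have "(real_of_int i - 1/2) * dx < x" "x < (real_of_int i + 1/2) * dx"
    using assms(2) by (auto simp: cell_def)
  then have "real_of_int i - 1/2 < x / dx" "x / dx < real_of_int i + 1/2"
    using assms(1) by (simp_all add: pos_less_divide_eq pos_divide_less_eq)
  then show ?thesis by (intro floor_unique) auto
qed

lemma time_index:
  fixes n :: nat
  assumes "0 < dt" "real n * dt \<le> t" "t < (real n + 1) * dt"
  shows "nat \<lfloor>t / dt\<rfloor> = n"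
proof -
  have "real n \<le> t / dt" "t / dt < real n + 1"
    using assms by (simp_all add: pos_le_divide_eq pos_divide_less_eq)
  then have "\<lfloor>t / dt\<rfloor> = int n" by (intro floor_unique) auto
  then show ?thesis by simp
qed


section \<open>Integration on the network\<close>

lemma finite_edges: "finite (edges Nin Nout)"
  by (simp add: edges_def edges_in_def edges_out_def)

lemma edge_dom_lebesgue: "edge_dom k \<in> sets lebesgue"
  by (auto simp: edge_dom_def)

lemma sigma_finite_lebesgue: "sigma_finite_measure (lebesgue :: real measure)"
proof -
  obtain A :: "real set set" where A: "countable A" "A \<subseteq> sets lborel" "\<Union>A = space lborel"
    "\<forall>a\<in>A. emeasure lborel a \<noteq> \<infinity>"
    using lborel.sigma_finite_countable by blast
  show ?thesis
  proof
    show "\<exists>A. countable A \<and> A \<subseteq> sets lebesgue \<and> \<Union>A = space (lebesgue :: real measure) \<and>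
        (\<forall>a\<in>A. emeasure lebesgue a \<noteq> \<infinity>)"
      using A by (intro exI[of _ A]) (auto simp: emeasure_completion main_part_sets subset_iff)
  qed
qed

lemma Omega_sets:
  "Omega Nin Nout \<in> sets (lebesgue \<Otimes>\<^sub>M count_space (edges Nin Nout))"
proof -
  have "Omega Nin Nout = (\<Union>k\<in>edges Nin Nout. edge_dom k \<times> {k})"
    by (auto simp: Omega_def)
  also have "\<dots> \<in> sets (lebesgue \<Otimes>\<^sub>M count_space (edges Nin Nout))"
    using finite_edges edge_dom_lebesgue by (intro sets.finite_UN pair_measureI) auto
  finally show ?thesis .
qed

lemma nn_integral_net_measure:
  assumes g: "g \<in> borel_measurable (net_measure Nin Nout)"
  shows "(\<integral>\<^sup>+ z. g z \<partial>net_measure Nin Nout) =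
    (\<Sum>k\<in>edges Nin Nout. \<integral>\<^sup>+ x. g (x, k) \<partial>lebesgue_on (edge_dom k))"
proof -
  let ?E = "edges Nin Nout" and ?O = "Omega Nin Nout"
  let ?M = "lebesgue \<Otimes>\<^sub>M count_space ?E"
  interpret L: sigma_finite_measure "lebesgue :: real measure" by (rule sigma_finite_lebesgue)
  interpret C: sigma_finite_measure "count_space ?E"
    by (rule sigma_finite_measure_count_space_finite) (rule finite_edges)
  interpret P: pair_sigma_finite "lebesgue :: real measure" "count_space ?E" ..
  have O: "?O \<inter> space ?M \<in> sets ?M"
    using Omega_sets by (simp add: sets.Int_space_eq2)
  have m: "(\<lambda>z. g z * indicator ?O z) \<in> borel_measurable ?M"
    using g O unfolding net_measure_def by (subst (asm) borel_measurable_restrict_space_iff_ennreal) auto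
  have "(\<integral>\<^sup>+ z. g z \<partial>net_measure Nin Nout) = (\<integral>\<^sup>+ z. g z * indicator ?O z \<partial>?M)"
    unfolding net_measure_def using O by (rule nn_integral_restrict_space)
  also have "\<dots> = (\<integral>\<^sup>+ k. (\<integral>\<^sup>+ x. g (x, k) * indicator ?O (x, k) \<partial>lebesgue) \<partial>count_space ?E)"
    using m by (rule P.nn_integral_snd[symmetric])
  also have "\<dots> = (\<Sum>k\<in>?E. \<integral>\<^sup>+ x. g (x, k) * indicator ?O (x, k) \<partial>lebesgue)"
    by (rule nn_integral_count_space_finite[OF finite_edges])
  also have "\<dots> = (\<Sum>k\<in>?E. \<integral>\<^sup>+ x. g (x, k) * indicator (edge_dom k) x \<partial>lebesgue)"
    by (intro sum.cong refl nn_integral_cong) (auto simp: Omega_def indicator_def)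
  also have "\<dots> = (\<Sum>k\<in>?E. \<integral>\<^sup>+ x. g (x, k) \<partial>lebesgue_on (edge_dom k))"
    using edge_dom_lebesgue by (intro sum.cong refl nn_integral_restrict_space[symmetric]) simp
  finally show ?thesis .
qed

end

theory Submission
  imports Defs
begin

text \<open>Monotonicity of the scheme alone makes each \<open>F k\<close> nondecreasing in its first and nonincreasing in
  its second argument, with Lipschitz constant \<open>dx / dt\<close>. For ordered grids \<open>u \<le> w\<close> the mass of
  \<open>w - u\<close> in the cells \<open>\<bar>i\<bar> \<le> m\<close> after one step is therefore at most its mass in the cells
  \<open>\<bar>i\<bar> \<le> m + 1\<close> before the step: the fluxes at the vertex and at interior interfaces telescope, and
  the outer flux difference is dominated by the mass of the next cell. Comparing \<open>u\<close> and \<open>v\<close> with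
  \<open>max u v\<close> gives the same bound for \<open>\<bar>u - v\<bar>\<close>, and iterating it and letting \<open>m\<close> tend to infinity
  gives the contraction without any limit of the fluxes at infinity.\<close>

section \<open>Mass and distance of grids on finite windows of cells\<close>

definition grid_map2 :: "(real \<Rightarrow> real \<Rightarrow> real) \<Rightarrow> net_grid \<Rightarrow> net_grid \<Rightarrow> net_grid" where
  "grid_map2 h u v = \<lparr> vertex = h (vertex u) (vertex v), edge = (\<lambda>k i. h (edge u k i) (edge v k i)) \<rparr>"

definition near_cells :: "int \<Rightarrow> nat \<Rightarrow> int set" where
  "near_cells k m = disc_dom k \<inter> {- int m..int m}"

text \<open>The integral of the piecewise constant function of \<open>w\<close> over the vertex cell
  and the cells of index at most \<open>m\<close> in modulus. The vertex cell is counted once, with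
  its full width over all edges. The truncation at \<open>m\<close> gives a finite sum also for
  grids that are not summable.\<close>

definition grid_mass :: "nat \<Rightarrow> nat \<Rightarrow> real \<Rightarrow> nat \<Rightarrow> net_grid \<Rightarrow> real" where
  "grid_mass Nin Nout dx m w = vertex_width Nin Nout dx * vertex w +
     dx * (\<Sum>k\<in>edges Nin Nout. \<Sum>i\<in>near_cells k m. edge w k i)"

abbreviation grid_dist :: "nat \<Rightarrow> nat \<Rightarrow> real \<Rightarrow> nat \<Rightarrow> net_grid \<Rightarrow> net_grid \<Rightarrow> real" where
  "grid_dist Nin Nout dx m u v \<equiv> grid_mass Nin Nout dx m (grid_map2 (\<lambda>x y. \<bar>x - y\<bar>) u v)"

lemma near_cells_in: "k \<in> edges_in Nin \<Longrightarrow> near_cells k m = {- int m..-1}"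
  by (auto simp: edges_in_def near_cells_def disc_dom_def)

lemma near_cells_out: "k \<in> edges_out Nout \<Longrightarrow> near_cells k m = {1..int m}"
  by (auto simp: edges_out_def near_cells_def disc_dom_def)

lemma finite_near_cells [simp]: "finite (near_cells k m)"
  by (simp add: near_cells_def)

lemma near_cells_disc_dom: "i \<in> near_cells k m \<Longrightarrow> i \<in> disc_dom k"
  by (simp add: near_cells_def)

lemma sum_edges:
  "(\<Sum>k\<in>edges Nin Nout. g k) = (\<Sum>k\<in>edges_in Nin. g k) + (\<Sum>k\<in>edges_out Nout. g k)"
  for g :: "int \<Rightarrow> 'a :: comm_monoid_add"
  unfolding edges_def by (rule sum.union_disjoint) (auto simp: edges_in_def edges_out_def)

lemma card_edges: "card (edges Nin Nout) = Nin + Nout"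
  unfolding edges_def by (subst card_Un_disjoint) (auto simp: edges_in_def edges_out_def)

lemma vertex_width_pos: "Nin \<ge> 1 \<Longrightarrow> dx > 0 \<Longrightarrow> vertex_width Nin Nout dx > 0"
  by (simp add: vertex_width_def)

lemma grid_mass_mono:
  assumes "grid_le Nin Nout u v" "dx > 0"
  shows "grid_mass Nin Nout dx m u \<le> grid_mass Nin Nout dx m v"
  unfolding grid_mass_def using assms near_cells_disc_dom
  by (intro add_mono mult_left_mono sum_mono) (auto simp: grid_le_def vertex_width_def)

section \<open>Conservation of mass up to the outer fluxes\<close>

lemma sum_telescope_int:
  fixes g :: "int \<Rightarrow> real"
  shows "(\<Sum>i\<in>{1..int m}. g i - g (i - 1)) = g (int m) - g 0"
    and "(\<Sum>i\<in>{- int m..-1}. g i - g (i - 1)) = g (-1) - g (- int m - 1)"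
proof -
  show "(\<Sum>i\<in>{1..int m}. g i - g (i - 1)) = g (int m) - g 0"
  proof (induction m)
    case (Suc m)
    have "{1..int (Suc m)} = insert (int m + 1) {1..int m}" by auto
    with Suc show ?case by (simp add: add.commute)
  qed simp
  show "(\<Sum>i\<in>{- int m..-1}. g i - g (i - 1)) = g (-1) - g (- int m - 1)"
  proof (induction m)
    case (Suc m)
    have "{- int (Suc m)..-1} = insert (- int m - 1) {- int m..-1}" by auto
    with Suc show ?case by simp
  qed simp
qed

lemma near_cells_Suc_in:
  fixes g :: "int \<Rightarrow> real"
  assumes k: "k \<in> edges_in Nin"
  shows "(\<Sum>i\<in>near_cells k (Suc m). g i) = g (- int m - 1) + (\<Sum>i\<in>near_cells k m. g i)"
proof -
  have "{- int (Suc m)..-1} = insert (- int m - 1) {- int m..-1}" by auto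
  then show ?thesis by (simp add: near_cells_in[OF k])
qed

lemma near_cells_Suc_out:
  fixes g :: "int \<Rightarrow> real"
  assumes k: "k \<in> edges_out Nout"
  shows "(\<Sum>i\<in>near_cells k (Suc m). g i) = g (int m + 1) + (\<Sum>i\<in>near_cells k m. g i)"
proof -
  have "{1..int (Suc m)} = insert (int m + 1) {1..int m}" by auto
  then show ?thesis by (simp add: near_cells_out[OF k])
qed

text \<open>The fluxes telescope along each edge, and those left over at the vertex cancel against
  the vertex update, which the weight \<open>vertex_width\<close> turns into a flux balance with
  factor \<open>dt\<close>. For \<open>m = 0\<close> the outer interfaces are those of the vertex
  cell itself.\<close>

lemma grid_mass_fv_step:
  fixes w :: net_grid
  assumes "Nin \<ge> 1" "dx > 0"
  shows "grid_mass Nin Nout dx m (fv_step Nin Nout F dt dx w) = grid_mass Nin Nout dx m w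
    + dt * (\<Sum>k\<in>edges_in Nin. F k (gval w k (- int m - 1)) (gval w k (- int m)))
    - dt * (\<Sum>k\<in>edges_out Nout. F k (gval w k (int m)) (gval w k (int m + 1)))"
proof -
  \<comment> \<open>\<open>g k i\<close> is the flux through the right interface of cell
    \<open>i\<close>, so the fluxes at the vertex cell are \<open>g k (-1)\<close> on incoming and
    \<open>g k 0\<close> on outgoing edges.\<close>
  define g where "g k i = F k (gval w k i) (gval w k (i + 1))" for k i
  let ?V = "vertex_width Nin Nout dx"
  have edge: "edge (fv_step Nin Nout F dt dx w) k i =
      edge w k i - dt / dx * (g k i - g k (i - 1))" if "i \<in> near_cells k m" for k i
    using that by (auto simp: fv_step_def g_def gval_def near_cells_def disc_dom_def split: if_splits)
  have sum: "dx * (\<Sum>i\<in>near_cells k m. edge (fv_step Nin Nout F dt dx w) k i) =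
      dx * (\<Sum>i\<in>near_cells k m. edge w k i) - dt * (\<Sum>i\<in>near_cells k m. g k i - g k (i - 1))" for k
  proof -
    have "(\<Sum>i\<in>near_cells k m. edge (fv_step Nin Nout F dt dx w) k i) =
        (\<Sum>i\<in>near_cells k m. edge w k i) - dt / dx * (\<Sum>i\<in>near_cells k m. g k i - g k (i - 1))"
      by (simp add: edge sum_subtractf sum_distrib_left[symmetric] sum_divide_distrib[symmetric])
    then show ?thesis using assms by (simp add: right_diff_distrib)
  qed
  have i: "dx * (\<Sum>i\<in>near_cells k m. edge (fv_step Nin Nout F dt dx w) k i) =
      dx * (\<Sum>i\<in>near_cells k m. edge w k i) - dt * (g k (-1) - g k (- int m - 1))"
    if "k \<in> edges_in Nin" for k
    using sum[of k] unfolding near_cells_in[OF that] sum_telescope_int .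
  have o: "dx * (\<Sum>i\<in>near_cells k m. edge (fv_step Nin Nout F dt dx w) k i) =
      dx * (\<Sum>i\<in>near_cells k m. edge w k i) - dt * (g k (int m) - g k 0)"
    if "k \<in> edges_out Nout" for k
    using sum[of k] unfolding near_cells_out[OF that] sum_telescope_int .
  have v: "?V * vertex (fv_step Nin Nout F dt dx w) =
      ?V * vertex w - dt * ((\<Sum>k\<in>edges_out Nout. g k 0) - (\<Sum>k\<in>edges_in Nin. g k (-1)))"
    using vertex_width_pos[OF assms, of Nout] by (simp add: fv_step_def g_def field_simps)
  have "grid_mass Nin Nout dx m (fv_step Nin Nout F dt dx w) = grid_mass Nin Nout dx m w
      + dt * (\<Sum>k\<in>edges_in Nin. g k (- int m - 1)) - dt * (\<Sum>k\<in>edges_out Nout. g k (int m))"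
    unfolding grid_mass_def v sum_edges distrib_left sum_distrib_left[of dx]
    by (simp add: i o sum_subtractf sum.distrib sum_distrib_left[symmetric] algebra_simps)
  then show ?thesis by (simp add: g_def)
qed

section \<open>Monotonicity of the numerical fluxes and contraction on windows\<close>

lemma monotone_fv_cell:
  assumes "monotone_fv Nin Nout F dt dx" "k \<in> edges Nin Nout"
    and "a \<le> a'" "b \<le> b'" "c \<le> c'"
  shows "b - dt / dx * (F k b c - F k a b) \<le> b' - dt / dx * (F k b' c' - F k a' b')"
proof -
  \<comment> \<open>The second cell from the vertex: neither it nor a neighbour has index 0, so
    \<open>gval\<close> reads three edge values that can be prescribed independently.\<close>
  define s :: int where "s = (if k < 0 then -2 else 2)"
  define w :: "real \<Rightarrow> real \<Rightarrow> real \<Rightarrow> net_grid" where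
    "w x y z = \<lparr> vertex = 0, edge = (\<lambda>_ i. if i < s then x else if i = s then y else z) \<rparr>" for x y z
  have "grid_le Nin Nout (w a b c) (w a' b' c')"
    using assms by (auto simp: grid_le_def w_def)
  then have "grid_le Nin Nout (fv_step Nin Nout F dt dx (w a b c)) (fv_step Nin Nout F dt dx (w a' b' c'))"
    using assms by (simp add: monotone_fv_def)
  moreover have "s \<in> disc_dom k"
    by (auto simp: s_def disc_dom_def)
  ultimately have "edge (fv_step Nin Nout F dt dx (w a b c)) k s \<le>
      edge (fv_step Nin Nout F dt dx (w a' b' c')) k s"
    using assms(2) by (simp add: grid_le_def)
  moreover have "s \<noteq> 0" "s - 1 \<noteq> 0" "s + 1 \<noteq> 0"
    by (auto simp: s_def)
  ultimately show ?thesis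
    by (simp add: fv_step_def gval_def w_def)
qed

context
  fixes Nin Nout :: nat and F :: "int \<Rightarrow> real \<Rightarrow> real \<Rightarrow> real" and dt dx :: real
  assumes mono: "monotone_fv Nin Nout F dt dx" and dt: "dt > 0" and dx: "dx > 0"
begin

text \<open>In this and the next lemma only one neighbour of a cell varies, so the centre value and
  the flux on the other side cancel from the cell inequality.\<close>

lemma flux_mono_left: "k \<in> edges Nin Nout \<Longrightarrow> a \<le> a' \<Longrightarrow> F k a b \<le> F k a' b"
  using monotone_fv_cell[OF mono, of k a a' b b b b] dt dx by (simp add: divide_simps)

lemma flux_antimono_right: "k \<in> edges Nin Nout \<Longrightarrow> b \<le> b' \<Longrightarrow> F k a b' \<le> F k a b"
  using monotone_fv_cell[OF mono, of k a a a a b b'] dt dx by (simp add: divide_simps)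

text \<open>A bound of CFL type: the update is nondecreasing in the centre value, so raising that
  value increases the net outflow, scaled by \<open>dt / dx\<close>, by no more than the
  raise.\<close>

lemma flux_diff_bound:
  assumes k: "k \<in> edges Nin Nout" and "a \<le> a'" "b \<le> b'"
  shows "dt * (F k a' b' - F k a b) \<le> dx * (a' - a)"
    and "dt * (F k a b - F k a' b') \<le> dx * (b' - b)"
proof -
  \<comment> \<open>The centre goes from \<open>a\<close> to \<open>a'\<close> between the fixed
    neighbours \<open>a\<close> and \<open>b\<close>; the change of the inflow,
    \<open>F k a a' - F k a a\<close>, has the favourable sign.\<close>
  have "a - dt / dx * (F k a b - F k a a) \<le> a' - dt / dx * (F k a' b - F k a a')"
    using assms by (intro monotone_fv_cell[OF mono k]) auto
  then have "dx * (a - dt / dx * (F k a b - F k a a)) \<le> dx * (a' - dt / dx * (F k a' b - F k a a'))"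
    using dx by simp
  then have "dt * (F k a' b - F k a b) \<le> dx * (a' - a) + dt * (F k a a' - F k a a)"
    using dx by (simp add: algebra_simps)
  moreover have "dt * (F k a a' - F k a a) \<le> 0"
    using flux_antimono_right[OF k \<open>a \<le> a'\<close>] dt by (simp add: mult_nonneg_nonpos)
  moreover have "dt * (F k a' b' - F k a b) \<le> dt * (F k a' b - F k a b)"
    using flux_antimono_right[OF k \<open>b \<le> b'\<close>] dt by simp
  ultimately show "dt * (F k a' b' - F k a b) \<le> dx * (a' - a)" by linarith
  \<comment> \<open>The mirror image: the centre goes from \<open>b\<close> to \<open>b'\<close>
    between the fixed neighbours \<open>a\<close> and \<open>b\<close>, and the change of the
    outflow has the favourable sign.\<close>
  have "b - dt / dx * (F k b b - F k a b) \<le> b' - dt / dx * (F k b' b - F k a b')"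
    using assms by (intro monotone_fv_cell[OF mono k]) auto
  then have "dx * (b - dt / dx * (F k b b - F k a b)) \<le> dx * (b' - dt / dx * (F k b' b - F k a b'))"
    using dx by simp
  then have "dt * (F k a b - F k a b') \<le> dx * (b' - b) + dt * (F k b b - F k b' b)"
    using dx by (simp add: algebra_simps)
  moreover have "dt * (F k b b - F k b' b) \<le> 0"
    using flux_mono_left[OF k \<open>b \<le> b'\<close>] dt by (simp add: mult_nonneg_nonpos)
  moreover have "dt * (F k a b - F k a' b') \<le> dt * (F k a b - F k a b')"
    using flux_mono_left[OF k \<open>a \<le> a'\<close>] dt by simp
  ultimately show "dt * (F k a b - F k a' b') \<le> dx * (b' - b)" by linarith
qed

text \<open>By conservation only the differences of the outer fluxes have to be bounded. The cell
  just outside the window is the left argument of the outer flux on incoming edges and the right one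
  on outgoing edges, so the two halves of \<open>flux_diff_bound\<close> give the mass that the
  window \<open>Suc m\<close> adds.\<close>

lemma grid_mass_fv_step_diff_le:
  assumes "Nin \<ge> 1" "grid_le Nin Nout u w"
  shows "grid_mass Nin Nout dx m (fv_step Nin Nout F dt dx w) - grid_mass Nin Nout dx m (fv_step Nin Nout F dt dx u)
    \<le> grid_mass Nin Nout dx (Suc m) w - grid_mass Nin Nout dx (Suc m) u"
proof -
  \<comment> \<open>Index 0 is included because for \<open>m = 0\<close> the inner neighbour of an
    outer interface is the vertex cell.\<close>
  have le: "gval u k i \<le> gval w k i" if "k \<in> edges Nin Nout" "i = 0 \<or> i \<in> disc_dom k" for k i
    using assms(2) that by (auto simp: grid_le_def gval_def)
  let ?L = "\<lambda>z k. F k (gval z k (- int m - 1)) (gval z k (- int m))"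
  let ?R = "\<lambda>z k. F k (gval z k (int m)) (gval z k (int m + 1))"
  have i: "dt * (?L w k - ?L u k) \<le> dx * (edge w k (- int m - 1) - edge u k (- int m - 1))"
    if "k \<in> edges_in Nin" for k
  proof -
    have "k \<in> edges Nin Nout" "- int m - 1 \<in> disc_dom k" "- int m = 0 \<or> - int m \<in> disc_dom k"
      using that by (auto simp: edges_def edges_in_def disc_dom_def)
    then have "dt * (?L w k - ?L u k) \<le> dx * (gval w k (- int m - 1) - gval u k (- int m - 1))"
      by (intro flux_diff_bound(1) le) auto
    then show ?thesis by (simp add: gval_def)
  qed
  have o: "dt * (?R u k - ?R w k) \<le> dx * (edge w k (int m + 1) - edge u k (int m + 1))"
    if "k \<in> edges_out Nout" for k
  proof -
    have "k \<in> edges Nin Nout" "int m + 1 \<in> disc_dom k" "int m = 0 \<or> int m \<in> disc_dom k"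
      using that by (auto simp: edges_def edges_out_def disc_dom_def)
    then have "dt * (?R u k - ?R w k) \<le> dx * (gval w k (int m + 1) - gval u k (int m + 1))"
      by (intro flux_diff_bound(2) le) auto
    then show ?thesis by (simp add: gval_def)
  qed
  have "(\<Sum>k\<in>edges_in Nin. dt * (?L w k - ?L u k)) \<le>
      (\<Sum>k\<in>edges_in Nin. dx * (edge w k (- int m - 1) - edge u k (- int m - 1)))"
    by (rule sum_mono) (rule i)
  moreover have "(\<Sum>k\<in>edges_out Nout. dt * (?R u k - ?R w k)) \<le>
      (\<Sum>k\<in>edges_out Nout. dx * (edge w k (int m + 1) - edge u k (int m + 1)))"
    by (rule sum_mono) (rule o)
  moreover have Suc: "grid_mass Nin Nout dx (Suc m) z = grid_mass Nin Nout dx m z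
      + dx * (\<Sum>k\<in>edges_in Nin. edge z k (- int m - 1)) + dx * (\<Sum>k\<in>edges_out Nout. edge z k (int m + 1))" for z
    unfolding grid_mass_def sum_edges
    by (simp add: near_cells_Suc_in near_cells_Suc_out sum.distrib algebra_simps)
  ultimately show ?thesis
    unfolding grid_mass_fv_step[OF assms(1) dx] Suc
    by (simp add: sum_distrib_left[symmetric] sum_subtractf right_diff_distrib)
qed

text \<open>The argument of Crandall and Tartar.\<close>

lemma grid_dist_fv_step_le:
  assumes "Nin \<ge> 1"
  shows "grid_dist Nin Nout dx m (fv_step Nin Nout F dt dx u) (fv_step Nin Nout F dt dx v)
    \<le> grid_dist Nin Nout dx (Suc m) u v"
proof -
  let ?S = "fv_step Nin Nout F dt dx" and ?m = "grid_mass Nin Nout dx"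
  define w where "w = grid_map2 max u v"
  have u: "grid_le Nin Nout u w" and v: "grid_le Nin Nout v w"
    by (auto simp: grid_le_def w_def grid_map2_def)
  then have Su: "grid_le Nin Nout (?S u) (?S w)" and Sv: "grid_le Nin Nout (?S v) (?S w)"
    using mono by (auto simp: monotone_fv_def)
  \<comment> \<open>\<open>?D a b c\<close> is \<open>(c - a) + (c - b)\<close>, whose mass is
    linear in the three grids. It bounds |a - b| whenever \<open>c\<close> lies above
    \<open>a\<close> and \<open>b\<close>, as \<open>?S w\<close> does after the step, with equality
    when \<open>c\<close> is their maximum, as before the step.\<close>
  let ?D = "\<lambda>a b c. grid_map2 (+) (grid_map2 (-) c a) (grid_map2 (-) c b)"
  have D: "?m n (?D a b c) = (?m n c - ?m n a) + (?m n c - ?m n b)" for n a b c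
    by (simp only: grid_mass_def grid_map2_def net_grid.simps sum.distrib sum_subtractf) (simp add: algebra_simps)
  have "grid_dist Nin Nout dx m (?S u) (?S v) \<le> ?m m (?D (?S u) (?S v) (?S w))"
    using Su Sv by (intro grid_mass_mono dx) (fastforce simp: grid_le_def grid_map2_def)
  also have "\<dots> \<le> ?m (Suc m) (?D u v w)"
    unfolding D by (intro add_mono grid_mass_fv_step_diff_le assms u v)
  also have "?D u v w = grid_map2 (\<lambda>x y. \<bar>x - y\<bar>) u v"
    by (auto simp: w_def grid_map2_def max_def fun_eq_iff)
  finally show ?thesis .
qed

text \<open>The numerical domain of dependence grows by one cell per step, hence the induction with
  \<open>m\<close> arbitrary.\<close>

lemma grid_dist_fv_iterate_le:
  assumes "Nin \<ge> 1"
  shows "grid_dist Nin Nout dx m ((fv_step Nin Nout F dt dx ^^ n) u) ((fv_step Nin Nout F dt dx ^^ n) v)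
    \<le> grid_dist Nin Nout dx (m + n) u v"
proof (induction n arbitrary: m)
  case (Suc n)
  show ?case
    using order_trans[OF grid_dist_fv_step_le[OF assms] Suc[of "Suc m"]] by simp
qed simp

end

section \<open>The L1 norm of piecewise constant functions on the network\<close>

lemma lebesgue_floor_cell:
  fixes dx :: real and i :: int
  assumes "dx > 0"
  defines "S \<equiv> {x :: real. \<lfloor>x / dx + 1/2\<rfloor> = i}"
  shows "S \<in> sets lebesgue"
    and "emeasure lebesgue (edge_dom k \<inter> S) =
      ennreal (if i = 0 then dx / 2 else if i \<in> disc_dom k then dx else 0)"
proof -
  have S: "S = {(real_of_int i - 1/2) * dx ..< (real_of_int i + 1/2) * dx}"
    using \<open>dx > 0\<close> by (auto simp: S_def floor_eq_iff field_simps)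
  then show "S \<in> sets lebesgue" by simp
  show "emeasure lebesgue (edge_dom k \<inter> S) =
      ennreal (if i = 0 then dx / 2 else if i \<in> disc_dom k then dx else 0)"
  \<comment> \<open>\<open>S\<close> is an interval of length \<open>dx\<close> centred at
    \<open>i * dx\<close>. The vertex halves it for \<open>i = 0\<close>; otherwise it lies on one
    side of the vertex, so the edge contains all or nothing of it.\<close>
  proof (cases "i = 0")
    case True
    have "edge_dom k \<inter> S = (if k < 0 then {- dx / 2..<0} else {0<..<dx / 2})"
      using \<open>dx > 0\<close> by (auto simp: S True edge_dom_def)
    then show ?thesis using \<open>dx > 0\<close> True by simp
  next
    case False
    have lo: "(real_of_int i - 1/2) * dx > 0" if "i > 0"
      using \<open>dx > 0\<close> that by simp
    have hi: "(real_of_int i + 1/2) * dx < 0" if "i < 0"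
      using \<open>dx > 0\<close> that by (simp add: mult_neg_pos)
    have "edge_dom k \<inter> S = (if i \<in> disc_dom k then S else {})"
    proof (cases "i > 0")
      case True
      then show ?thesis using lo[OF True] by (auto simp: S edge_dom_def disc_dom_def)
    next
      case f: False
      then have "i < 0" using False by simp
      then show ?thesis using hi by (auto simp: S edge_dom_def disc_dom_def)
    qed
    moreover have "emeasure lebesgue S = ennreal dx"
      using \<open>dx > 0\<close> by (simp add: S algebra_simps)
    ultimately show ?thesis using False by simp
  qed
qed

lemma snd_measurable_net_measure [measurable]:
  "snd \<in> measurable (net_measure Nin Nout) (count_space UNIV)"
  unfolding net_measure_def
  by (intro measurable_restrict_space1 measurable_compose[OF measurable_snd]) simp

lemma fst_measurable_net_measure [measurable]: "fst \<in> borel_measurable (net_measure Nin Nout)"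
  unfolding net_measure_def
  by (intro measurable_restrict_space1 measurable_compose[OF measurable_fst] measurable_completion) simp

text \<open>The function factors through the edge and the cell index, two measurable maps into
  countable discrete spaces, so \<open>g\<close> can be arbitrary.\<close>

lemma piecewise_constant_measurable [measurable]:
  fixes g :: "int \<Rightarrow> int \<Rightarrow> 'a :: topological_space"
  shows "(\<lambda>z. g (snd z) \<lfloor>fst z / dx + 1/2\<rfloor>) \<in> borel_measurable (net_measure Nin Nout)"
proof (rule measurable_compose_countable[OF _ snd_measurable_net_measure])
  have "(\<lambda>z. \<lfloor>fst z / dx + 1/2\<rfloor>) \<in> measurable (net_measure Nin Nout) (count_space UNIV)"
    by measurable
  then show "(\<lambda>z. g k \<lfloor>fst z / dx + 1/2\<rfloor>) \<in> borel_measurable (net_measure Nin Nout)" for k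
    by (rule measurable_compose) simp
qed

text \<open>The factor of \<open>g k 0\<close> is half a cell: the vertex cell has \<open>Nin + Nout\<close> branches of length \<open>dx / 2\<close>.\<close>

lemma nn_integral_piecewise_constant:
  fixes g :: "int \<Rightarrow> int \<Rightarrow> real"
  assumes "dx > 0" and nonneg: "\<And>k i. 0 \<le> g k i"
  shows "(\<integral>\<^sup>+ x. ennreal (g k \<lfloor>x / dx + 1/2\<rfloor>) * indicator {- int m..int m} \<lfloor>x / dx + 1/2\<rfloor>
      \<partial>lebesgue_on (edge_dom k)) = ennreal (dx / 2 * g k 0 + dx * (\<Sum>i\<in>near_cells k m. g k i))"
proof -
  define S :: "int \<Rightarrow> real set" where "S i = {x. \<lfloor>x / dx + 1/2\<rfloor> = i}" for i
  let ?w = "\<lambda>i. if i = 0 then dx / 2 else if i \<in> disc_dom k then dx else 0"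
  have [measurable]: "S i \<in> sets lebesgue" "edge_dom k \<in> sets lebesgue" for i
    using lebesgue_floor_cell(1)[OF \<open>dx > 0\<close>] edge_dom_lebesgue by (auto simp: S_def)
  have "(\<integral>\<^sup>+ x. ennreal (g k \<lfloor>x / dx + 1/2\<rfloor>) * indicator {- int m..int m} \<lfloor>x / dx + 1/2\<rfloor>
      \<partial>lebesgue_on (edge_dom k)) =
    (\<integral>\<^sup>+ x. ennreal (g k \<lfloor>x / dx + 1/2\<rfloor>) * indicator {- int m..int m} \<lfloor>x / dx + 1/2\<rfloor> *
      indicator (edge_dom k) x \<partial>lebesgue)"
    by (rule nn_integral_restrict_space) simp
  \<comment> \<open>The integrand is split along the level sets of the cell index, at most one of
    which contributes at each point.\<close>
  also have "\<dots> = (\<integral>\<^sup>+ x. (\<Sum>i\<in>{- int m..int m}. ennreal (g k i) * indicator (edge_dom k \<inter> S i) x) \<partial>lebesgue)"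
  proof (rule nn_integral_cong)
    fix x :: real
    have "(\<Sum>i\<in>{- int m..int m}. ennreal (g k i) * indicator (edge_dom k \<inter> S i) x) =
        (\<Sum>i\<in>{- int m..int m}. if \<lfloor>x / dx + 1/2\<rfloor> = i then ennreal (g k i) * indicator (edge_dom k) x else 0)"
      by (intro sum.cong refl) (auto simp: S_def indicator_def)
    then show "ennreal (g k \<lfloor>x / dx + 1/2\<rfloor>) * indicator {- int m..int m} \<lfloor>x / dx + 1/2\<rfloor> *
        indicator (edge_dom k) x = (\<Sum>i\<in>{- int m..int m}. ennreal (g k i) * indicator (edge_dom k \<inter> S i) x)"
      by (auto simp: indicator_def)
  qed
  also have "\<dots> = (\<Sum>i\<in>{- int m..int m}. ennreal (g k i) * emeasure lebesgue (edge_dom k \<inter> S i))"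
    by (subst nn_integral_sum) (simp_all add: nn_integral_cmult_indicator del: emeasure_completion)
  also have "\<dots> = (\<Sum>i\<in>{- int m..int m}. ennreal (g k i * ?w i))"
    using lebesgue_floor_cell(2)[OF \<open>dx > 0\<close>] \<open>dx > 0\<close> nonneg
    by (intro sum.cong refl) (auto simp: S_def ennreal_mult)
  also have "\<dots> = ennreal (\<Sum>i\<in>{- int m..int m}. g k i * ?w i)"
    using \<open>dx > 0\<close> nonneg by (intro sum_ennreal) auto
  \<comment> \<open>Indices on the other side of the vertex have weight zero.\<close>
  also have "(\<Sum>i\<in>{- int m..int m}. g k i * ?w i) = (\<Sum>i\<in>insert 0 (near_cells k m). g k i * ?w i)"
    by (rule sum.mono_neutral_right) (auto simp: near_cells_def)
  also have "\<dots> = dx / 2 * g k 0 + dx * (\<Sum>i\<in>near_cells k m. g k i)"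
    by (subst sum.insert)
      (auto simp: near_cells_def disc_dom_def sum_distrib_left mult.commute intro!: sum.cong split: if_splits)
  finally show ?thesis .
qed

text \<open>The windows exhaust the network, so monotone convergence turns a bound uniform in
  \<open>m\<close> into a bound of the whole norm; for finite \<open>B\<close> this includes its
  finiteness.\<close>

lemma L1_norm_projection_le:
  assumes "dx > 0" and bound: "\<And>m. ennreal (grid_dist Nin Nout dx m u v) \<le> B"
  shows "L1_norm Nin Nout (\<lambda>z. gval u (snd z) \<lfloor>fst z / dx + 1/2\<rfloor> - gval v (snd z) \<lfloor>fst z / dx + 1/2\<rfloor>) \<le> B"
proof -
  define g where "g k i = \<bar>gval u k i - gval v k i\<bar>" for k i
  define h where "h m z = ennreal (g (snd z) \<lfloor>fst z / dx + 1/2\<rfloor>) *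
    indicator {- int m..int m} \<lfloor>fst z / dx + 1/2\<rfloor>" for m and z :: "real \<times> int"
  have h_meas [measurable]: "h m \<in> borel_measurable (net_measure Nin Nout)" for m
    using piecewise_constant_measurable[of "\<lambda>k i. ennreal (g k i) * indicator {- int m..int m} i"]
    by (simp add: h_def[abs_def])
  have sup: "(SUP m. h m z) = ennreal (g (snd z) \<lfloor>fst z / dx + 1/2\<rfloor>)" for z
  proof (rule antisym)
    show "(SUP m. h m z) \<le> ennreal (g (snd z) \<lfloor>fst z / dx + 1/2\<rfloor>)"
      by (intro SUP_least) (auto simp: h_def indicator_def)
    \<comment> \<open>The supremum is attained as soon as the window contains the cell of
      \<open>z\<close>.\<close>
    have "ennreal (g (snd z) \<lfloor>fst z / dx + 1/2\<rfloor>) = h (nat \<bar>\<lfloor>fst z / dx + 1/2\<rfloor>\<bar>) z"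
      by (auto simp: h_def indicator_def)
    then show "ennreal (g (snd z) \<lfloor>fst z / dx + 1/2\<rfloor>) \<le> (SUP m. h m z)"
      by (auto intro: SUP_upper)
  qed
  have inc: "incseq h"
    by (auto simp: incseq_def le_fun_def h_def indicator_def)
  have "L1_norm Nin Nout (\<lambda>z. gval u (snd z) \<lfloor>fst z / dx + 1/2\<rfloor> - gval v (snd z) \<lfloor>fst z / dx + 1/2\<rfloor>) =
      (\<integral>\<^sup>+ z. (SUP m. h m z) \<partial>net_measure Nin Nout)"
    unfolding L1_norm_def sup by (simp add: g_def)
  also have "\<dots> = (SUP m. \<integral>\<^sup>+ z. h m z \<partial>net_measure Nin Nout)"
    using inc by (intro nn_integral_monotone_convergence_SUP) auto
  also have "\<dots> \<le> B"
  proof (rule SUP_least)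
    fix m
    have "(\<integral>\<^sup>+ z. h m z \<partial>net_measure Nin Nout) =
        (\<Sum>k\<in>edges Nin Nout. ennreal (dx / 2 * g k 0 + dx * (\<Sum>i\<in>near_cells k m. g k i)))"
      unfolding nn_integral_net_measure[OF h_meas]
      using nn_integral_piecewise_constant[OF \<open>dx > 0\<close>, of g] by (simp add: h_def g_def)
    also have "\<dots> = ennreal (\<Sum>k\<in>edges Nin Nout. dx / 2 * g k 0 + dx * (\<Sum>i\<in>near_cells k m. g k i))"
      using \<open>dx > 0\<close> by (intro sum_ennreal add_nonneg_nonneg mult_nonneg_nonneg sum_nonneg) (auto simp: g_def)
    also have "(\<Sum>k\<in>edges Nin Nout. dx / 2 * g k 0 + dx * (\<Sum>i\<in>near_cells k m. g k i)) =
        grid_dist Nin Nout dx m u v"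
    proof -
      have "(\<Sum>i\<in>near_cells k m. g k i) = (\<Sum>i\<in>near_cells k m. \<bar>edge u k i - edge v k i\<bar>)" for k
        by (intro sum.cong refl) (auto simp: g_def gval_def near_cells_def disc_dom_def split: if_splits)
      then show ?thesis
        by (simp add: grid_mass_def grid_map2_def vertex_width_def sum.distrib sum_distrib_left
            card_edges g_def gval_def)
    qed
    finally show "(\<integral>\<^sup>+ z. h m z \<partial>net_measure Nin Nout) \<le> B" using bound by simp
  qed
  finally show ?thesis .
qed

section \<open>Cell averages of the initial data\<close>

lemma measurable_section_net_measure:
  assumes "k \<in> edges Nin Nout"
  shows "(\<lambda>x. (x, k)) \<in> measurable (lebesgue_on (edge_dom k)) (net_measure Nin Nout)"
  unfolding net_measure_def
proof (rule measurable_restrict_space2)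
  show "(\<lambda>x. (x, k)) \<in> space (lebesgue_on (edge_dom k)) \<rightarrow> Omega Nin Nout"
    using assms by (auto simp: Omega_def)
  show "(\<lambda>x. (x, k)) \<in> measurable (lebesgue_on (edge_dom k)) (lebesgue \<Otimes>\<^sub>M count_space (edges Nin Nout))"
    using assms by (intro measurable_restrict_space1 measurable_Pair) auto
qed

text \<open>Subtracting the averages of two functions under one integral requires integrability on
  each edge. It holds because the finite norm is a sum of nonnegative contributions of the
  edges.\<close>

lemma integrable_section_net_measure:
  assumes k: "k \<in> edges Nin Nout" and u: "u \<in> L1 Nin Nout"
  shows "integrable (lebesgue_on (edge_dom k)) (\<lambda>x. u (x, k))"
proof (rule integrableI_bounded)
  have meas: "u \<in> borel_measurable (net_measure Nin Nout)"
    using u by (auto simp: L1_def)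
  then have n: "(\<lambda>z. ennreal (norm (u z))) \<in> borel_measurable (net_measure Nin Nout)" by measurable
  show "(\<lambda>x. u (x, k)) \<in> borel_measurable (lebesgue_on (edge_dom k))"
    using measurable_compose[OF measurable_section_net_measure[OF k] meas] .
  have "(\<integral>\<^sup>+ z. ennreal (norm (u z)) \<partial>net_measure Nin Nout) < \<infinity>"
    using u by (simp add: L1_def integrable_iff_bounded)
  then show "(\<integral>\<^sup>+ x. ennreal (norm (u (x, k))) \<partial>lebesgue_on (edge_dom k)) < \<infinity>"
    unfolding nn_integral_net_measure[OF n] using k finite_edges by (auto simp: less_top)
qed

text \<open>Averaging over disjoint cells does not increase the L1 distance. The vertex entries are
  prescribed values and not averages, so their distance enters as a separate term.\<close>

lemma grid_dist_init_grid_le: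
  assumes "dx > 0" and u: "u \<in> L1 Nin Nout" and v: "v \<in> L1 Nin Nout"
  shows "ennreal (grid_dist Nin Nout dx m (init_grid dx u c) (init_grid dx v d))
    \<le> L1_norm Nin Nout (\<lambda>z. u z - v z) + ennreal (vertex_width Nin Nout dx * \<bar>c 0 - d 0\<bar>)"
proof -
  let ?e = "\<lambda>k i. \<bar>edge (init_grid dx u c) k i - edge (init_grid dx v d) k i\<bar>"
  have cell_sets: "cell dx k i \<in> sets lebesgue" for k i
    using edge_dom_lebesgue by (auto simp: cell_def)
  have cell_sub: "cell dx k i \<subseteq> edge_dom k" for k i by (auto simp: cell_def)
  have cell: "ennreal (dx * ?e k i) \<le>
      (\<integral>\<^sup>+ x. ennreal \<bar>u (x, k) - v (x, k)\<bar> * indicator (cell dx k i) x \<partial>lebesgue)"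
    if k: "k \<in> edges Nin Nout" for k i
  proof -
    have int: "set_integrable lebesgue (cell dx k i) (\<lambda>x. w (x, k))" if "w \<in> L1 Nin Nout" for w
    proof -
      have "set_integrable lebesgue (edge_dom k) (\<lambda>x. w (x, k))"
        using integrable_section_net_measure[OF k that] edge_dom_lebesgue[of k]
        by (simp add: integrable_restrict_space set_integrable_def)
      then show ?thesis by (rule set_integrable_subset) (use cell_sets cell_sub in auto)
    qed
    \<comment> \<open>The factor \<open>1 / dx\<close> of the average cancels against the cell
      width.\<close>
    have "dx * ?e k i = \<bar>LINT x:cell dx k i|lebesgue. u (x, k) - v (x, k)\<bar>"
      using \<open>dx > 0\<close> int[OF u] int[OF v]
      by (simp add: init_grid_def diff_divide_distrib[symmetric] abs_divide)
    also have "ennreal \<dots> \<le> (\<integral>\<^sup>+ x. ennreal (norm (indicator (cell dx k i) x *\<^sub>R (u (x, k) - v (x, k)))) \<partial>lebesgue)"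
      unfolding set_lebesgue_integral_def real_norm_def[symmetric]
      by (rule integral_norm_bound_ennreal)
        (use set_integral_diff(1)[OF int[OF u] int[OF v]] in \<open>simp add: set_integrable_def\<close>)
    also have "\<dots> = (\<integral>\<^sup>+ x. ennreal \<bar>u (x, k) - v (x, k)\<bar> * indicator (cell dx k i) x \<partial>lebesgue)"
      by (intro nn_integral_cong) (auto simp: indicator_def)
    finally show ?thesis .
  qed
  have edge: "(\<Sum>i\<in>near_cells k m. ennreal (dx * ?e k i)) \<le>
      (\<integral>\<^sup>+ x. ennreal \<bar>u (x, k) - v (x, k)\<bar> \<partial>lebesgue_on (edge_dom k))"
    if k: "k \<in> edges Nin Nout" for k
  proof -
    let ?w = "\<lambda>x. ennreal \<bar>u (x, k) - v (x, k)\<bar>"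
    have m: "?w \<in> borel_measurable (lebesgue_on (edge_dom k))"
      using integrable_section_net_measure[OF k u] integrable_section_net_measure[OF k v] by measurable
    \<comment> \<open>Measurability is known only on \<open>edge_dom k\<close>, so the indicator of
      the edge is inserted first and then absorbed by that of the cell.\<close>
    have "(\<lambda>x. ?w x * indicator (edge_dom k) x) \<in> borel_measurable lebesgue"
      using m edge_dom_lebesgue[of k] by (subst (asm) borel_measurable_restrict_space_iff_ennreal) auto
    then have "(\<lambda>x. ?w x * indicator (edge_dom k) x * indicator (cell dx k i) x) \<in> borel_measurable lebesgue" for i
      using cell_sets[of k i] by measurable
    moreover have "(\<lambda>x. ?w x * indicator (edge_dom k) x * indicator (cell dx k i) x) =
        (\<lambda>x. ?w x * indicator (cell dx k i) x)" for i
      using cell_sub[of k i] by (auto simp: indicator_def fun_eq_iff)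
    ultimately have m': "(\<lambda>x. ?w x * indicator (cell dx k i) x) \<in> borel_measurable lebesgue" for i
      by simp
    have "(\<Sum>i\<in>near_cells k m. ennreal (dx * ?e k i)) \<le>
        (\<Sum>i\<in>near_cells k m. \<integral>\<^sup>+ x. ?w x * indicator (cell dx k i) x \<partial>lebesgue)"
      by (intro sum_mono cell k)
    also have "\<dots> = (\<integral>\<^sup>+ x. (\<Sum>i\<in>near_cells k m. ?w x * indicator (cell dx k i) x) \<partial>lebesgue)"
      by (rule nn_integral_sum[symmetric]) (rule m')
    also have "\<dots> \<le> (\<integral>\<^sup>+ x. ?w x * indicator (edge_dom k) x \<partial>lebesgue)"
    proof (rule nn_integral_mono)
      fix x
      \<comment> \<open>By \<open>cell_index\<close> a point lies in at most one cell.\<close>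
      have "(\<Sum>i\<in>near_cells k m. ?w x * indicator (cell dx k i) x) \<le>
          (\<Sum>i\<in>near_cells k m. if \<lfloor>x / dx + 1/2\<rfloor> = i then ?w x * indicator (edge_dom k) x else 0)"
        using cell_index[OF \<open>dx > 0\<close>] cell_sub by (intro sum_mono) (fastforce simp: indicator_def)
      also have "\<dots> \<le> ?w x * indicator (edge_dom k) x"
        by simp
      finally show "(\<Sum>i\<in>near_cells k m. ?w x * indicator (cell dx k i) x) \<le> ?w x * indicator (edge_dom k) x" .
    qed
    also have "\<dots> = (\<integral>\<^sup>+ x. ?w x \<partial>lebesgue_on (edge_dom k))"
      by (rule nn_integral_restrict_space[symmetric]) (simp add: edge_dom_lebesgue)
    finally show ?thesis .
  qed
  have meas: "(\<lambda>z. ennreal \<bar>u z - v z\<bar>) \<in> borel_measurable (net_measure Nin Nout)"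
  proof -
    have [measurable]: "u \<in> borel_measurable (net_measure Nin Nout)" "v \<in> borel_measurable (net_measure Nin Nout)"
      using u v by (auto simp: L1_def)
    show ?thesis by measurable
  qed
  have "ennreal (grid_dist Nin Nout dx m (init_grid dx u c) (init_grid dx v d)) =
      ennreal (vertex_width Nin Nout dx * \<bar>c 0 - d 0\<bar>) + ennreal (\<Sum>k\<in>edges Nin Nout. \<Sum>i\<in>near_cells k m. dx * ?e k i)"
    unfolding grid_mass_def sum_distrib_left using \<open>dx > 0\<close>
    by (subst ennreal_plus[symmetric])
      (auto simp: grid_map2_def init_grid_def vertex_width_def intro!: sum_nonneg)
  also have "ennreal (\<Sum>k\<in>edges Nin Nout. \<Sum>i\<in>near_cells k m. dx * ?e k i) =
      (\<Sum>k\<in>edges Nin Nout. \<Sum>i\<in>near_cells k m. ennreal (dx * ?e k i))"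
    using \<open>dx > 0\<close> by (simp add: sum_nonneg)
  also have "\<dots> \<le> L1_norm Nin Nout (\<lambda>z. u z - v z)"
    unfolding L1_norm_def nn_integral_net_measure[OF meas] by (intro sum_mono edge)
  finally show ?thesis by (simp add: add.commute add_left_mono)
qed

text \<open>The vertex values \<open>cu 0\<close> and \<open>cv 0\<close> are not determined by the
  data, and the projections see them on the vertex cell. For equal data the left side at time 0 is
  exactly the extra term of the second conjunct; when the vertex values agree this term vanishes,
  which gives the contraction.\<close>

theorem theorem4p12:
  fixes Nin Nout :: nat
    and f :: "int \<Rightarrow> real \<Rightarrow> real"
    and F :: "int \<Rightarrow> real \<Rightarrow> real \<Rightarrow> real"
    and dt dx :: real
    and G :: "(int \<Rightarrow> real) set"
    and ubar vbar :: "real \<times> int \<Rightarrow> real"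
    and cu du cv dv :: "int \<Rightarrow> real"
  assumes "Nin \<ge> 1" and "Nout \<ge> 1"
    and "\<forall>k\<in>edges Nin Nout. continuous_on UNIV (f k)"
    and "dt > 0" and "dx > 0"
    and "consistent_flux Nin Nout f F"
    and "monotone_fv Nin Nout F dt dx"
    and "G \<subseteq> discrete_stationary Nin Nout f F"
    and "ubar \<in> Linf_oco Nin Nout G \<inter> L1 Nin Nout"
    and "vbar \<in> Linf_oco Nin Nout G \<inter> L1 Nin Nout"
    and "init_bounds Nin Nout f F G ubar cu du"
    and "init_bounds Nin Nout f F G vbar cv dv"
  shows "(cu 0 = cv 0 \<longrightarrow> (\<forall>t\<ge>0.
      L1_norm Nin Nout (\<lambda>z. fv_projection Nin Nout F dt dx ubar cu t z
                            - fv_projection Nin Nout F dt dx vbar cv t z)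
        \<le> L1_norm Nin Nout (\<lambda>z. ubar z - vbar z))) \<and>
    (\<forall>t\<ge>0.
      L1_norm Nin Nout (\<lambda>z. fv_projection Nin Nout F dt dx ubar cu t z
                            - fv_projection Nin Nout F dt dx vbar cv t z)
        \<le> L1_norm Nin Nout (\<lambda>z. ubar z - vbar z)
           + ennreal (vertex_width Nin Nout dx * \<bar>cu 0 - cv 0\<bar>))"
proof -
  let ?d = "\<lambda>t z. fv_projection Nin Nout F dt dx ubar cu t z - fv_projection Nin Nout F dt dx vbar cv t z"
  have main: "L1_norm Nin Nout (?d t) \<le> L1_norm Nin Nout (\<lambda>z. ubar z - vbar z)
      + ennreal (vertex_width Nin Nout dx * \<bar>cu 0 - cv 0\<bar>)" (is "_ \<le> ?B") for t
  proof -
    define n where "n = nat \<lfloor>t / dt\<rfloor>"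
    define sol where "sol = fv_solution Nin Nout F dt dx"
    have "ennreal (grid_dist Nin Nout dx m (sol ubar cu n) (sol vbar cv n)) \<le> ?B" for m
    proof -
      have "ennreal (grid_dist Nin Nout dx m (sol ubar cu n) (sol vbar cv n)) \<le>
          ennreal (grid_dist Nin Nout dx (m + n) (init_grid dx ubar cu) (init_grid dx vbar cv))"
        using assms unfolding sol_def fv_solution_def by (intro ennreal_leI grid_dist_fv_iterate_le) auto
      also have "\<dots> \<le> ?B"
        using assms by (intro grid_dist_init_grid_le) auto
      finally show ?thesis .
    qed
    then have "L1_norm Nin Nout (\<lambda>z. gval (sol ubar cu n) (snd z) \<lfloor>fst z / dx + 1/2\<rfloor>
        - gval (sol vbar cv n) (snd z) \<lfloor>fst z / dx + 1/2\<rfloor>) \<le> ?B"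
      using \<open>dx > 0\<close> by (intro L1_norm_projection_le)
    then show ?thesis
      by (simp add: fv_projection_def case_prod_beta sol_def n_def)
  qed
  show ?thesis
    using main by (intro conjI impI allI) (auto dest: spec)
qed

end
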